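(* Let $p$ be a prime, $q$ a power of $p$, $\xi\in\mathbb{F}_q((T^{-1}))$ and $n$ a positive integer. Then $w_n(\xi)=w_n^{\mathrm{sep}}(\xi)$, $\widehat{w}_n(\xi)=\widehat{w}_n^{\mathrm{sep}}(\xi)$, $w_n(\xi)=w_n(\xi^p)$ and $\widehat{w}_n(\xi)=\widehat{w}_n(\xi^p)$.
   Context: $\mathbb{F}_q$ is the field with $q$ elements. For a nonzero $\xi=\sum_{k\ge N} a_k T^{-k}\in\mathbb{F}_q((T^{-1}))$ with $a_N\neq 0$, set $|\xi|=q^{-N}$, and $|0|=0$. The height $H(P)$ of $P\in\mathbb{F}_q[T][X]$ is the maximum of the absolute values of its coefficients. $w_n(\xi)$ is the supremum of the real $w$ such that $0<|P(\xi)|<H(P)^{-w}$ has infinitely many solutions $P\in\mathbb{F}_q[T][X]$ of degree at most $n$; $w_n^{\mathrm{sep}}(\xi)$ is defined in the same way but requiring in addition that $P$ be separable. $\widehat{w}_n(\xi)$ (resp. $\widehat{w}_n^{\mathrm{sep}}(\xi)$) is the supremum of the real $\widehat w$ for which there is $H_0$ such that for every $H>H_0$ there is a polynomial (resp. a separable polynomial) $P\in\mathbb{F}_q[T][X]$ of degree at most $n$ and height at most $H$ with $0<|P(\xi)|<H^{-\widehat w}$. *)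

theory Defs
  imports
    Complex_Main
    "HOL-Library.Extended_Real"
    "HOL-Library.Cardinality"
    "HOL-Computational_Algebra.Computational_Algebra"
    "HOL-Algebra.Algebraic_Closure_Type"
begin

text \<open>
  A type \<open>'a\<close> of class \<open>{finite, field}\<close> plays the role of the field with \<open>q = CARD('a)\<close>
  elements. The field of Laurent series in \<open>1/T\<close> over it is \<open>'a fls\<close>, whose formal variable
  \<open>fls_X\<close> stands for \<open>1/T\<close>; hence \<open>T\<close> is \<open>fls_X_inv\<close>. Elements of the polynomial ring in
  \<open>T\<close> are \<open>'a poly\<close>, and polynomials in \<open>X\<close> over that ring are \<open>'a poly poly\<close>.
\<close>

definition abs_fls :: "'a::{finite,field} fls \<Rightarrow> real"
  where "abs_fls \<xi> = (if \<xi> = 0 then 0 else real CARD('a) powi (- fls_subdegree \<xi>))"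

definition poly_to_fls :: "'a::{finite,field} poly \<Rightarrow> 'a fls"
  where "poly_to_fls a = poly (map_poly fls_const a) fls_X_inv"

definition eval_at :: "'a::{finite,field} poly poly \<Rightarrow> 'a fls \<Rightarrow> 'a fls"
  where "eval_at P \<xi> = poly (map_poly poly_to_fls P) \<xi>"

definition height :: "'a::{finite,field} poly poly \<Rightarrow> real"
  where "height P = Max ((\<lambda>i. abs_fls (poly_to_fls (coeff P i))) ` {..degree P})"

text \<open>
  Separability of a polynomial is understood in the sense that each of its irreducible factors
  over the field of rational functions in \<open>T\<close> has only simple roots in an algebraic closure of
  that field. A repeated factor is thus allowed. With the more restrictive convention that the
  polynomial itself has only simple roots, the uniform exponents of a Liouville series and their
  separable analogues differ: with the sum of \<open>T^(-k!)\<close> over \<open>k \<ge> 1\<close> and \<open>n = 2\<close>, the former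
  is at least 2, whereas the latter would be at most 1.
\<close>

definition separable_poly :: "'a::{finite,field} poly poly \<Rightarrow> bool"
  where "separable_poly P \<longleftrightarrow>
    P \<noteq> 0 \<and>
    (\<forall>Q :: 'a poly fract poly.
       irreducible Q \<and> Q dvd map_poly to_fract P \<longrightarrow> rsquarefree (map_poly to_ac Q))"

text \<open>
  The exponents below are relative to a set \<open>A\<close> of admissible polynomials. They are taken in the
  extended reals because the suprema may be infinite.
\<close>

definition w_exponent_on ::
    "'a::{finite,field} poly poly set \<Rightarrow> nat \<Rightarrow> 'a fls \<Rightarrow> ereal"
  where "w_exponent_on A n \<xi> =
    Sup (ereal ` {w. infinite {P \<in> A. degree P \<le> n \<and>
           0 < abs_fls (eval_at P \<xi>) \<and> abs_fls (eval_at P \<xi>) < height P powr (- w)}})"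

definition w_hat_exponent_on ::
    "'a::{finite,field} poly poly set \<Rightarrow> nat \<Rightarrow> 'a fls \<Rightarrow> ereal"
  where "w_hat_exponent_on A n \<xi> =
    Sup (ereal ` {w. \<exists>H\<^sub>0::real. \<forall>H>H\<^sub>0. \<exists>P\<in>A. degree P \<le> n \<and> height P \<le> H \<and>
           0 < abs_fls (eval_at P \<xi>) \<and> abs_fls (eval_at P \<xi>) < H powr (- w)})"

definition w_exponent :: "nat \<Rightarrow> 'a::{finite,field} fls \<Rightarrow> ereal"
  where "w_exponent = w_exponent_on UNIV"

definition w_exponent_sep :: "nat \<Rightarrow> 'a::{finite,field} fls \<Rightarrow> ereal"
  where "w_exponent_sep = w_exponent_on {P. separable_poly P}"

definition w_hat_exponent :: "nat \<Rightarrow> 'a::{finite,field} fls \<Rightarrow> ereal"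
  where "w_hat_exponent = w_hat_exponent_on UNIV"

definition w_hat_exponent_sep :: "nat \<Rightarrow> 'a::{finite,field} fls \<Rightarrow> ereal"
  where "w_hat_exponent_sep = w_hat_exponent_on {P. separable_poly P}"

end

theory Submission
  imports Defs
begin

text \<open>
  Since \<open>F\<^sub>q\<close> is perfect, every \<open>P\<close> in \<open>F\<^sub>q[T][X]\<close> satisfies \<open>P(X\<^sup>p) = (\<Sum>j<p. T\<^sup>j B\<^sub>j(X)\<^sup>p)\<close>, and
  evaluation at \<open>\<xi>\<close> produces nonzero summands of distinct absolute values only. So some \<open>B = B\<^sub>j\<close> satisfies
  \<open>0 < |B(\<xi>)|\<^sup>p \<le> |P(\<xi>\<^sup>p)|\<close> and \<open>H(B)\<^sup>p \<le> H(P)\<close>, which compares the exponents of \<open>\<xi>\<^sup>p\<close> with those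
  of \<open>\<xi>\<close>; conversely \<open>P(X)\<^sup>p = Q(X\<^sup>p)\<close>, where \<open>Q\<close> has the \<open>p\<close>-th powers of the coefficients of
  \<open>P\<close>. An inseparable irreducible factor has the form \<open>R(X\<^sup>p)\<close> and may be replaced by \<open>B\<^sup>p\<close>
  with \<open>B\<close> obtained from \<open>R\<close>, without increasing degree, height or value at \<open>\<xi>\<close>; iterating
  gives a separable polynomial at least as good as the original one.
\<close>

section \<open>The absolute value on Laurent series in 1/T\<close>

lemma card_field_gt_1: "real CARD('a::{finite,field}) > 1"
proof -
  have "card {0, 1 :: 'a} \<le> CARD('a)" by (rule card_mono) auto
  then show ?thesis by simp
qed

lemma prime_CHAR_finite_field: "prime CHAR('a::{finite,field})"
  using finite_imp_CHAR_pos[where 'a='a] prime_CHAR_semidom[where 'a='a] by simp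

lemma abs_fls_0 [simp]: "abs_fls 0 = 0"
  by (simp add: abs_fls_def)

lemma abs_fls_pos_iff [simp]: "0 < abs_fls x \<longleftrightarrow> x \<noteq> 0"
  for x :: "'a::{finite,field} fls"
  using card_field_gt_1[where 'a='a] by (simp add: abs_fls_def)

lemma abs_fls_nonneg [simp]: "0 \<le> abs_fls x"
  by (simp add: abs_fls_def)

lemma abs_fls_mult: "abs_fls (x * y) = abs_fls x * abs_fls y"
  for x :: "'a::{finite,field} fls"
  using card_field_gt_1[where 'a='a]
  by (simp add: abs_fls_def flip: power_int_add)

lemma abs_fls_1 [simp]: "abs_fls 1 = 1"
  by (simp add: abs_fls_def)

lemma abs_fls_power: "abs_fls (x ^ n) = abs_fls x ^ n"
  by (induction n) (simp_all add: abs_fls_mult)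

lemma abs_fls_mono:
  fixes x y :: "'a::{finite,field} fls"
  assumes "y \<noteq> 0" "fls_subdegree y \<le> fls_subdegree x"
  shows "abs_fls x \<le> abs_fls y"
  using assms card_field_gt_1[where 'a='a] by (simp add: abs_fls_def power_int_increasing)

text \<open>The nonzero summand of least subdegree is unique, so its leading coefficient survives in
  the sum; the sum is at least as large as that summand, hence as every other.\<close>

lemma abs_fls_le_sum:
  fixes f :: "'b \<Rightarrow> 'a::{finite,field} fls"
  assumes "finite A"
    and distinct: "\<And>i j. i \<in> A \<Longrightarrow> j \<in> A \<Longrightarrow> i \<noteq> j \<Longrightarrow> f i \<noteq> 0 \<Longrightarrow> f j \<noteq> 0 \<Longrightarrow>
           fls_subdegree (f i) \<noteq> fls_subdegree (f j)"
    and "i \<in> A"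
  shows "abs_fls (f i) \<le> abs_fls (sum f A)"
proof (cases "f i = 0")
  case False
  let ?M = "{j \<in> A. f j \<noteq> 0}"
  have "finite ?M" "?M \<noteq> {}" using assms False by auto
  then obtain m where m: "m \<in> ?M" "\<And>j. j \<in> ?M \<Longrightarrow> fls_subdegree (f m) \<le> fls_subdegree (f j)"
    using arg_min_if_finite(1)[of ?M "\<lambda>j. fls_subdegree (f j)"]
      arg_min_least[of ?M _ "\<lambda>j. fls_subdegree (f j)"] by blast
  define d where "d = fls_subdegree (f m)"
  have "fls_nth (f j) d = 0" if "j \<in> A - {m}" for j
  proof (cases "f j = 0")
    case False
    then have "d < fls_subdegree (f j)"
      using m distinct[of j m] that unfolding d_def by force
    then show ?thesis by simp
  qed simp
  then have "fls_nth (sum f A) d = fls_nth (f m) d"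
    using m(1) \<open>finite A\<close> by (simp add: fls_nth_sum sum.remove[of A m])
  then have nz: "fls_nth (sum f A) d \<noteq> 0" using m(1) by (simp add: d_def)
  then have "fls_subdegree (sum f A) \<le> d" by (rule fls_subdegree_leI)
  also have "d \<le> fls_subdegree (f i)" unfolding d_def using m(2) assms(3) False by simp
  finally show ?thesis using nz by (intro abs_fls_mono) auto
qed simp

text \<open>Since |T| > 1, the factor T^j never shrinks a summand, and the subdegrees of the nonzero
  summands lie in the pairwise distinct classes of -j modulo n, so nothing cancels.\<close>

lemma abs_fls_le_frobenius_sum:
  fixes f :: "nat \<Rightarrow> 'a::{finite,field} fls"
  assumes "i < n"
  shows "abs_fls (f i) ^ n \<le> abs_fls (\<Sum>j<n. fls_X_inv ^ j * f j ^ n)"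
proof -
  have "1 \<le> abs_fls (fls_X_inv :: 'a fls) ^ i"
    using card_field_gt_1[where 'a='a] by (simp add: abs_fls_def one_le_power)
  then have "abs_fls (f i) ^ n \<le> abs_fls (fls_X_inv :: 'a fls) ^ i * abs_fls (f i) ^ n"
    using mult_right_mono[of 1 "abs_fls (fls_X_inv :: 'a fls) ^ i" "abs_fls (f i) ^ n"] by simp
  also have "\<dots> = abs_fls (fls_X_inv ^ i * f i ^ n)"
    by (simp add: abs_fls_mult abs_fls_power)
  also have "\<dots> \<le> abs_fls (\<Sum>j<n. fls_X_inv ^ j * f j ^ n)"
  proof (rule abs_fls_le_sum)
    fix j k assume jk: "j \<in> {..<n}" "k \<in> {..<n}" "j \<noteq> k"
      and nz: "fls_X_inv ^ j * f j ^ n \<noteq> 0" "fls_X_inv ^ k * f k ^ n \<noteq> 0"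
    have *: "(- fls_subdegree (fls_X_inv ^ l * f l ^ n)) mod int n = int l"
      if "l < n" "fls_X_inv ^ l * f l ^ n \<noteq> 0" for l
    proof -
      have "- fls_subdegree (fls_X_inv ^ l * f l ^ n) = int l + int n * (- fls_subdegree (f l))"
        using that by (simp add: fls_subdegree_pow)
      then show ?thesis using that(1) by (simp del: mult_minus_right)
    qed
    show "fls_subdegree (fls_X_inv ^ j * f j ^ n) \<noteq> fls_subdegree (fls_X_inv ^ k * f k ^ n)"
      by (metis * jk nz lessThan_iff of_nat_eq_iff)
  qed (use assms in auto)
  finally show ?thesis .
qed

section \<open>Evaluation of polynomials in T and in X\<close>

text \<open>Evaluation after a ring homomorphism on the coefficients occurs three times: inserting T
  (\<open>poly_to_fls\<close>), inserting \<xi> (\<open>eval_at\<close>), and inserting elements of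
  an algebraic closure (\<open>to_ac\<close>).\<close>

locale poly_hom =
  fixes f :: "'a::comm_ring_1 \<Rightarrow> 'b::comm_ring_1" and x :: 'b
  assumes f_0: "f 0 = 0" and f_1: "f 1 = 1"
    and f_add: "f (a + b) = f a + f b" and f_mult: "f (a * b) = f a * f b"
begin

lemma eval_pCons: "poly (map_poly f (pCons a P)) x = f a + x * poly (map_poly f P) x"
  by (simp add: map_poly_pCons f_0)

lemma eval_add: "poly (map_poly f (P + Q)) x = poly (map_poly f P) x + poly (map_poly f Q) x"
proof -
  have "map_poly f (P + Q) = map_poly f P + map_poly f Q"
    by (rule poly_eqI) (simp add: coeff_map_poly f_0 f_add)
  then show ?thesis by simp
qed

lemma eval_smult: "poly (map_poly f (smult a P)) x = f a * poly (map_poly f P) x"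
  by (simp add: map_poly_smult f_0 f_mult)

lemma eval_mult: "poly (map_poly f (P * Q)) x = poly (map_poly f P) x * poly (map_poly f Q) x"
  by (induction P) (simp_all add: eval_pCons eval_add eval_smult f_0 algebra_simps)

lemma eval_1: "poly (map_poly f 1) x = 1"
  by (simp add: f_1)

end

interpretation poly_to_fls: poly_hom fls_const "fls_X_inv :: 'a::{finite,field} fls"
  rewrites "poly (map_poly fls_const a) fls_X_inv = poly_to_fls a"
  by unfold_locales (simp_all add: poly_to_fls_def fls_plus_const fls_const_mult_const)

lemma poly_to_fls_0 [simp]: "poly_to_fls 0 = 0"
  by (simp add: poly_to_fls_def)

interpretation eval_at: poly_hom "poly_to_fls :: 'a::{finite,field} poly \<Rightarrow> 'a fls" \<xi>
  rewrites "poly (map_poly poly_to_fls P) \<xi> = eval_at P \<xi>"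
  for \<xi>
  by unfold_locales (simp_all add: eval_at_def poly_to_fls.eval_1 poly_to_fls.eval_add poly_to_fls.eval_mult)

lemma eval_at_0 [simp]: "eval_at 0 \<xi> = 0"
  by (simp add: eval_at_def)

lemma eval_at_power: "eval_at (P ^ n) \<xi> = eval_at P \<xi> ^ n"
  by (induction n) (simp_all add: eval_at.eval_1 eval_at.eval_mult)

lemma poly_to_fls_sum: "poly_to_fls (\<Sum>i\<in>A. f i) = (\<Sum>i\<in>A. poly_to_fls (f i))"
  by (induction A rule: infinite_finite_induct) (simp_all add: poly_to_fls.eval_add)

lemma poly_to_fls_power: "poly_to_fls (a ^ n) = poly_to_fls a ^ n"
  by (induction n) (simp_all add: poly_to_fls.eval_1 poly_to_fls.eval_mult)

lemma poly_to_fls_monom: "poly_to_fls (monom 1 n) = fls_X_inv ^ n"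
  by (induction n) (simp_all add: monom_Suc poly_to_fls.eval_pCons monom_0)

lemma fls_nth_poly_to_fls:
  "fls_nth (poly_to_fls a) k = (if k \<le> 0 then coeff a (nat (- k)) else 0)"
proof (induction a arbitrary: k)
  case (pCons c a)
  \<comment> \<open>Multiplication by T shifts the index, hence the induction over arbitrary
    k.\<close>
  have "fls_nth (poly_to_fls (pCons c a)) k = fls_nth (fls_const c) k + fls_nth (poly_to_fls a) (k + 1)"
    by (simp add: poly_to_fls.eval_pCons fls_X_inv_times_conv_shift)
  then show ?case
    by (auto simp: pCons.IH coeff_pCons nat_diff_distrib split: nat.splits)
qed simp

lemma poly_to_fls_eq_0_iff [simp]: "poly_to_fls a = 0 \<longleftrightarrow> a = 0"
proof
  assume "poly_to_fls a = 0"
  then have "coeff a n = 0" for n using fls_nth_poly_to_fls[of a "- int n"] by simp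
  then show "a = 0" by (intro poly_eqI) simp
qed simp

lemma abs_fls_poly_to_fls:
  "abs_fls (poly_to_fls a) = (if a = 0 then 0 else real CARD('a) ^ degree a)"
  for a :: "'a::{finite,field} poly"
proof (cases "a = 0")
  case False
  have "fls_subdegree (poly_to_fls a) = - int (degree a)"
    by (rule fls_subdegree_eqI) (use False in \<open>auto simp: fls_nth_poly_to_fls coeff_eq_0\<close>)
  with False show ?thesis by (simp add: abs_fls_def)
qed simp

lemma eval_at_eq_sum:
  fixes P :: "'a::{finite,field} poly poly"
  assumes "degree P \<le> n"
  shows "eval_at P x = (\<Sum>i\<le>n. poly_to_fls (coeff P i) * x ^ i)"
proof -
  have "eval_at P x = (\<Sum>i\<le>degree P. poly_to_fls (coeff P i) * x ^ i)"
    by (simp add: eval_at_def poly_altdef degree_map_poly coeff_map_poly)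
  also have "\<dots> = (\<Sum>i\<le>n. poly_to_fls (coeff P i) * x ^ i)"
    using assms by (intro sum.mono_neutral_left) (auto simp: coeff_eq_0)
  finally show ?thesis .
qed

section \<open>The height as a multiplicative Gauss norm\<close>

text \<open>Coefficients beyond the degree have absolute value 0, and 0 \<le> C follows from the
  coefficient at index 0. With all indices allowed, heights are compared without tracking
  degrees.\<close>

lemma height_le_iff: "height P \<le> C \<longleftrightarrow> (\<forall>i. abs_fls (poly_to_fls (coeff P i)) \<le> C)"
proof
  assume *: "height P \<le> C"
  then have le: "abs_fls (poly_to_fls (coeff P i)) \<le> C" if "i \<le> degree P" for i
    using that unfolding height_def by simp
  have "0 \<le> C" using le[of 0] abs_fls_nonneg[of "poly_to_fls (coeff P 0)"] by linarith
  then show "\<forall>i. abs_fls (poly_to_fls (coeff P i)) \<le> C"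
    using le by (metis abs_fls_0 coeff_eq_0 leI poly_to_fls_0)
qed (simp add: height_def)

lemma abs_coeff_le_height: "abs_fls (poly_to_fls (coeff P i)) \<le> height P"
  using height_le_iff[of P "height P"] by simp

lemma height_attained: "\<exists>i. height P = abs_fls (poly_to_fls (coeff P i))"
proof -
  have "height P \<in> (\<lambda>i. abs_fls (poly_to_fls (coeff P i))) ` {..degree P}"
    unfolding height_def by (rule Max_in) auto
  then show ?thesis by auto
qed

lemma height_0 [simp]: "height 0 = 0"
  by (simp add: height_def)

lemma height_nonneg [simp]: "0 \<le> height P"
  using order_trans[OF abs_fls_nonneg abs_coeff_le_height] .

lemma height_eqI:
  fixes P :: "'a::{finite,field} poly poly"
  assumes "\<And>i. degree (coeff P i) \<le> d" "coeff (coeff P j) d \<noteq> 0"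
  shows "height P = real CARD('a) ^ d"
proof (rule antisym)
  have q: "real CARD('a) \<ge> 1" using card_field_gt_1[where 'a='a] by simp
  show "height P \<le> real CARD('a) ^ d"
    unfolding height_le_iff using assms(1) q by (auto simp: abs_fls_poly_to_fls power_increasing)
  have "degree (coeff P j) = d" using assms by (simp add: antisym le_degree)
  moreover have "coeff P j \<noteq> 0" using assms(2) by auto
  ultimately show "real CARD('a) ^ d \<le> height P"
    using abs_coeff_le_height[of P j] by (simp add: abs_fls_poly_to_fls)
qed

text \<open>Here d is the degree of P in T, and j marks a coefficient that attains it. This
  translates heights into degrees.\<close>

lemma height_cases:
  fixes P :: "'a::{finite,field} poly poly"
  assumes "P \<noteq> 0"
  obtains d j where "height P = real CARD('a) ^ d" "\<And>i. degree (coeff P i) \<le> d"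
    "coeff (coeff P j) d \<noteq> 0"
proof -
  have q: "real CARD('a) > 1" using card_field_gt_1[where 'a='a] .
  obtain j where j: "height P = abs_fls (poly_to_fls (coeff P j))" using height_attained by blast
  have "lead_coeff P \<noteq> 0" using assms by simp
  then have "0 < abs_fls (poly_to_fls (lead_coeff P))" by simp
  also have "\<dots> \<le> height P" by (rule abs_coeff_le_height)
  finally have nz: "coeff P j \<noteq> 0" using j by auto
  show thesis
  proof (rule that[of "degree (coeff P j)" j])
    fix i
    show "degree (coeff P i) \<le> degree (coeff P j)"
      using abs_coeff_le_height[of P i] j nz q
      by (cases "coeff P i = 0") (auto simp: abs_fls_poly_to_fls)
  qed (use j nz in \<open>auto simp: abs_fls_poly_to_fls\<close>)
qed

lemma height_ge_1: "P \<noteq> 0 \<Longrightarrow> height P \<ge> 1"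
  for P :: "'a::{finite,field} poly poly"
  using card_field_gt_1[where 'a='a] by (elim height_cases) (simp add: one_le_power)

text \<open>The numbers m and n are only upper bounds: if one of them is not attained, both sides
  vanish.\<close>

lemma coeff_mult_of_degree_le:
  fixes a b :: "'a::idom poly"
  assumes "degree a \<le> m" "degree b \<le> n"
  shows "coeff (a * b) (m + n) = coeff a m * coeff b n"
proof (cases "degree a = m \<and> degree b = n")
  case True
  then show ?thesis using coeff_mult_degree_sum[of a b] by auto
next
  case False
  then have "degree (a * b) < m + n" "degree a < m \<or> degree b < n"
    using assms degree_mult_le[of a b] by auto
  then show ?thesis by (auto simp: coeff_eq_0)
qed

text \<open>The parts of P and Q of top degree in T are nonzero polynomials in X over a field, so
  their product is nonzero, and it is the top part of P * Q.\<close>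

lemma height_mult: "height (P * Q) = height P * height Q"
  for P Q :: "'a::{finite,field} poly poly"
proof (cases "P = 0 \<or> Q = 0")
  case False
  then have "P \<noteq> 0" "Q \<noteq> 0" by auto
  obtain d i where P: "height P = real CARD('a) ^ d" "\<And>i. degree (coeff P i) \<le> d"
    "coeff (coeff P i) d \<noteq> 0" using height_cases[OF \<open>P \<noteq> 0\<close>] by metis
  obtain e j where Q: "height Q = real CARD('a) ^ e" "\<And>i. degree (coeff Q i) \<le> e"
    "coeff (coeff Q j) e \<noteq> 0" using height_cases[OF \<open>Q \<noteq> 0\<close>] by metis
  \<comment> \<open>\<open>L m R\<close> is the coefficient of T^m in R, a polynomial in X.\<close>
  define L where "L m R = map_poly (\<lambda>a. coeff a m) R" for m and R :: "'a poly poly"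
  have coeff_L: "coeff (L m R) k = coeff (coeff R k) m" for m R k
    by (simp add: L_def coeff_map_poly)
  have "L (d + e) (P * Q) = L d P * L e Q"
    by (rule poly_eqI)
      (simp add: coeff_L coeff_mult[of P] coeff_mult[of "L d P"] coeff_sum P(2) Q(2) coeff_mult_of_degree_le)
  moreover have "L d P \<noteq> 0" "L e Q \<noteq> 0" using P(3) Q(3) coeff_L by (metis coeff_0)+
  ultimately have "L (d + e) (P * Q) \<noteq> 0" by simp
  then obtain k where "coeff (L (d + e) (P * Q)) k \<noteq> 0" using leading_coeff_neq_0 by blast
  then have k: "coeff (coeff (P * Q) k) (d + e) \<noteq> 0" by (simp add: coeff_L)
  have "degree (coeff (P * Q) m) \<le> d + e" for m
    unfolding coeff_mult
    by (intro degree_sum_le order_trans[OF degree_mult_le] add_mono P(2) Q(2)) auto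
  from height_eqI[OF this k] show ?thesis by (simp add: P(1) Q(1) power_add)
qed auto

lemma height_1 [simp]: "height 1 = 1"
  by (simp add: height_def poly_to_fls.eval_1)

lemma height_power: "height (P ^ n) = height P ^ n"
  by (induction n) (simp_all add: height_mult)

section \<open>Frobenius: decomposing P(X^p) and taking p-th powers\<close>

lemma freshmans_dream_sum_fls:
  fixes f :: "'b \<Rightarrow> 'a::{finite,field} fls"
  shows "(\<Sum>i\<in>A. f i) ^ CHAR('a) = (\<Sum>i\<in>A. f i ^ CHAR('a))"
  by (rule freshmans_dream_sum) (simp_all add: prime_CHAR_finite_field)

lemma frobenius_surj_finite_field: "\<exists>y. x = y ^ CHAR('a)"
  for x :: "'a::{finite,field}"
proof -
  have "inj (\<lambda>y::'a. y ^ CHAR('a))"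
  proof (rule injI)
    fix y z :: 'a assume "y ^ CHAR('a) = z ^ CHAR('a)"
    \<comment> \<open>Additivity applied to y = (y - z) + z yields (y - z)^p = 0 without any sign to
      discuss.\<close>
    moreover have "((y - z) + z) ^ CHAR('a) = (y - z) ^ CHAR('a) + z ^ CHAR('a)"
      by (rule freshmans_dream) (simp_all add: prime_CHAR_finite_field)
    ultimately show "y = z" by simp
  qed
  then have "surj (\<lambda>y::'a. y ^ CHAR('a))" by (simp add: finite_UNIV_inj_surj)
  then show ?thesis by (metis surjD)
qed

text \<open>Prepending a constant multiplies the old terms by T, which moves index j to j + 1. The
  term at p - 1 becomes T^p b^p = (T b)^p and merges at index 0 with the constant, itself a p-th
  power because the field is perfect.\<close>

lemma poly_frobenius_decomposition:
  fixes a :: "'a::{finite,field} poly"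
  shows "\<exists>b. a = (\<Sum>j<CHAR('a). monom 1 j * b j ^ CHAR('a))"
proof (induction a)
  case 0
  have "CHAR('a) > 0" using prime_CHAR_finite_field prime_gt_0_nat by blast
  then show ?case by (intro exI[of _ "\<lambda>_. 0"]) (simp add: zero_power)
next
  case (pCons c a)
  obtain r where r: "CHAR('a) = Suc r"
    using prime_CHAR_finite_field[where 'a='a] prime_gt_0_nat gr0_implies_Suc by blast
  obtain b where b: "a = (\<Sum>j<CHAR('a). monom 1 j * b j ^ CHAR('a))" using pCons.IH by blast
  obtain d where d: "c = d ^ CHAR('a)" using frobenius_surj_finite_field by blast
  define e where "e = [:d:] + monom 1 1 * b r"
  define b' where "b' j = (case j of 0 \<Rightarrow> e | Suc i \<Rightarrow> b i)" for j
  have "e ^ CHAR('a) = [:d:] ^ CHAR('a) + (monom 1 1 * b r) ^ CHAR('a)"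
    unfolding e_def by (rule freshmans_dream) (simp_all add: prime_CHAR_finite_field)
  then have e: "e ^ CHAR('a) = [:d:] ^ CHAR('a) + monom 1 (CHAR('a)) * b r ^ CHAR('a)"
    by (simp add: power_mult_distrib monom_power)
  have "pCons c a = [:c:] + monom 1 1 * a"
    by (simp add: monom_Suc monom_0)
  also have "monom 1 1 * a = (\<Sum>j<CHAR('a). monom 1 (Suc j) * b j ^ CHAR('a))"
    by (subst b) (simp add: sum_distrib_left monom_Suc monom_0)
  also have "\<dots> = (\<Sum>j<r. monom 1 (Suc j) * b j ^ CHAR('a)) + monom 1 (CHAR('a)) * b r ^ CHAR('a)"
    by (simp add: r)
  also have "[:c:] = [:d:] ^ CHAR('a)" by (simp add: d poly_const_pow)
  also have "[:d:] ^ CHAR('a) + ((\<Sum>j<r. monom 1 (Suc j) * b j ^ CHAR('a))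
      + monom 1 (CHAR('a)) * b r ^ CHAR('a)) = (\<Sum>j<CHAR('a). monom 1 j * b' j ^ CHAR('a))"
    unfolding r sum.lessThan_Suc_shift
    by (simp add: b'_def e[unfolded r] monom_0 add_ac del: power_Suc)
  finally show ?case by blast
qed

text \<open>\<open>B j\<close> collects the j-th components of all coefficients of P. Both bounds
  hold for every j < p, so j can be chosen solely to make the value of \<open>B j\<close> at \<xi>
  nonzero.\<close>

lemma exists_frobenius_root:
  fixes P :: "'a::{finite,field} poly poly"
  assumes "eval_at P (\<xi> ^ CHAR('a)) \<noteq> 0"
  obtains B where "degree B \<le> degree P" "height B ^ CHAR('a) \<le> height P" "eval_at B \<xi> \<noteq> 0"
    "abs_fls (eval_at B \<xi>) ^ CHAR('a) \<le> abs_fls (eval_at P (\<xi> ^ CHAR('a)))"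
proof -
  let ?p = "CHAR('a)"
  have p_pos: "?p > 0" using prime_CHAR_finite_field prime_gt_0_nat by blast
  obtain b :: "'a poly \<Rightarrow> nat \<Rightarrow> 'a poly"
    where b: "a = (\<Sum>j<?p. monom 1 j * b a j ^ ?p)" for a
    using poly_frobenius_decomposition by metis
  have b_fls: "poly_to_fls a = (\<Sum>j<?p. fls_X_inv ^ j * poly_to_fls (b a j) ^ ?p)" for a
    by (subst b) (simp add: poly_to_fls_sum poly_to_fls.eval_mult poly_to_fls_power poly_to_fls_monom)
  have b_le: "abs_fls (poly_to_fls (b a j)) ^ ?p \<le> abs_fls (poly_to_fls a)" if "j < ?p" for a j
    unfolding b_fls[of a] by (rule abs_fls_le_frobenius_sum[OF that])
  define B where "B j = (\<Sum>i\<le>degree P. monom (b (coeff P i) j) i)" for j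
  have coeff_B: "coeff (B j) i = (if i \<le> degree P then b (coeff P i) j else 0)" for i j
    by (simp add: B_def coeff_sum)
  have deg_B: "degree (B j) \<le> degree P" for j
    by (rule degree_le) (simp add: coeff_B)
  have "eval_at P (\<xi> ^ ?p) = (\<Sum>i\<le>degree P. (\<Sum>j<?p. fls_X_inv ^ j * poly_to_fls (b (coeff P i) j) ^ ?p) * (\<xi> ^ ?p) ^ i)"
    unfolding eval_at_eq_sum[OF order_refl] by (simp flip: b_fls)
  also have "\<dots> = (\<Sum>j<?p. \<Sum>i\<le>degree P. fls_X_inv ^ j * (poly_to_fls (b (coeff P i) j) * \<xi> ^ i) ^ ?p)"
    unfolding sum_distrib_right
    by (subst sum.swap) (simp add: power_mult_distrib mult_ac flip: power_mult)
  also have "\<dots> = (\<Sum>j<?p. fls_X_inv ^ j * eval_at (B j) \<xi> ^ ?p)"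
    unfolding eval_at_eq_sum[OF deg_B] coeff_B by (simp add: freshmans_dream_sum_fls sum_distrib_left)
  finally have P_eq: "eval_at P (\<xi> ^ ?p) = (\<Sum>j<?p. fls_X_inv ^ j * eval_at (B j) \<xi> ^ ?p)" .
  have "\<exists>j<?p. eval_at (B j) \<xi> \<noteq> 0"
  proof (rule ccontr)
    assume "\<not> ?thesis"
    then have "eval_at P (\<xi> ^ ?p) = 0" unfolding P_eq using p_pos by (intro sum.neutral) auto
    with assms show False by simp
  qed
  then obtain j where j: "j < ?p" "eval_at (B j) \<xi> \<noteq> 0" by blast
  show thesis
  proof (rule that[of "B j"])
    obtain i where i: "height (B j) = abs_fls (poly_to_fls (coeff (B j) i))"
      using height_attained by blast
    have "abs_fls (poly_to_fls (coeff (B j) i)) ^ ?p \<le> abs_fls (poly_to_fls (coeff P i))"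
      using b_le[OF j(1), of "coeff P i"] p_pos by (simp add: coeff_B zero_power)
    also have "\<dots> \<le> height P" by (rule abs_coeff_le_height)
    finally show "height (B j) ^ ?p \<le> height P" unfolding i .
    show "abs_fls (eval_at (B j) \<xi>) ^ ?p \<le> abs_fls (eval_at P (\<xi> ^ ?p))"
      unfolding P_eq by (rule abs_fls_le_frobenius_sum[OF j(1)])
  qed (use deg_B j in auto)
qed

text \<open>Raising the coefficients of P to the p-th power gives Q with Q(X^p) = P(X)^p, because
  Frobenius is additive; the absolute values of the coefficients are raised to the same
  power.\<close>

lemma exists_frobenius_power:
  fixes P :: "'a::{finite,field} poly poly"
  obtains Q where "degree Q \<le> degree P" "height Q = height P ^ CHAR('a)"
    "eval_at Q (\<xi> ^ CHAR('a)) = eval_at P \<xi> ^ CHAR('a)"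
proof -
  let ?p = "CHAR('a)"
  define Q where "Q = map_poly (\<lambda>a. a ^ ?p) P"
  have p_pos: "?p > 0" using prime_CHAR_finite_field prime_gt_0_nat by blast
  have coeff_Q: "coeff Q i = coeff P i ^ ?p" for i
    using p_pos by (simp add: Q_def coeff_map_poly)
  have deg: "degree Q \<le> degree P" unfolding Q_def by (rule map_poly_degree_leq)
  moreover have "height Q = height P ^ ?p"
  proof (rule antisym)
    show "height Q \<le> height P ^ ?p"
      unfolding height_le_iff
      by (simp add: coeff_Q poly_to_fls_power abs_fls_power power_mono abs_coeff_le_height)
    obtain i where "height P = abs_fls (poly_to_fls (coeff P i))" using height_attained by blast
    then show "height P ^ ?p \<le> height Q"
      using abs_coeff_le_height[of Q i] by (simp add: coeff_Q poly_to_fls_power abs_fls_power)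
  qed
  moreover have "eval_at Q (\<xi> ^ ?p) = eval_at P \<xi> ^ ?p"
    unfolding Q_def using p_pos
  proof (induction P)
    case (pCons a P)
    have "map_poly (\<lambda>a. a ^ ?p) (pCons a P) = pCons (a ^ ?p) (map_poly (\<lambda>a. a ^ ?p) P)"
      using p_pos by (simp add: map_poly_pCons)
    moreover have "(poly_to_fls a + \<xi> * eval_at P \<xi>) ^ ?p
        = poly_to_fls a ^ ?p + (\<xi> * eval_at P \<xi>) ^ ?p"
      by (rule freshmans_dream) (simp_all add: prime_CHAR_finite_field)
    ultimately show ?case
      using pCons by (simp add: eval_at.eval_pCons poly_to_fls_power power_mult_distrib)
  qed simp
  ultimately show thesis by (rule that)
qed

section \<open>Inseparable factors over the rational functions, brought back to polynomials\<close>

text \<open>A form of Gauss's lemma: an irreducible c stays prime as a constant polynomial in X, so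
  it divides Q or R and is cancelled there. A general c is removed factor by factor, by induction on
  its degree.\<close>

lemma smult_eq_mult_imp_factors:
  fixes c :: "'a::field poly"
  assumes "c \<noteq> 0" "smult c P = Q * R"
  shows "\<exists>a b Q' R'. Q = smult a Q' \<and> R = smult b R' \<and> P = Q' * R'"
  using assms
proof (induction "degree c" arbitrary: c P Q R rule: less_induct)
  case less
  have cancel: "smult c P = smult c P' \<Longrightarrow> P = P'" for P'
    using less.prems(1) by (metis smult_cancel)
  consider "is_unit c" | "irreducible c" |
    a b where "c = a * b" "\<not> is_unit a" "\<not> is_unit b"
    using less.prems(1) by (auto simp: irreducible_def)
  then show ?case
  proof cases
    case 1
    then obtain d where d: "1 = c * d" by blast
    have "Q = smult c (smult d Q)" by (simp flip: d)
    moreover have "P = smult d Q * R"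
      using less.prems(2) by (intro cancel) (simp flip: d)
    moreover have "R = smult 1 R" by simp
    ultimately show ?thesis by blast
  next
    case 2
    then have "prime_elem [:c:]"
      by (intro lift_prime_elem_poly field_poly_irreducible_imp_prime)
    moreover have "[:c:] dvd Q * R" using less.prems(2) by (intro dvdI[of _ _ P]) simp
    ultimately have "[:c:] dvd Q \<or> [:c:] dvd R" by (simp add: prime_elem_dvd_mult_iff)
    then consider Q' where "Q = smult c Q'" | R' where "R = smult c R'" by (auto elim!: dvdE)
    then show ?thesis
    proof cases
      case 1
      then have "P = Q' * R" using less.prems(2) by (intro cancel) simp
      with 1 show ?thesis by (intro exI[of _ c] exI[of _ 1] exI[of _ Q'] exI[of _ R]) simp
    next
      case 2
      then have "P = Q * R'" using less.prems(2) by (intro cancel) simp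
      with 2 show ?thesis by (intro exI[of _ 1] exI[of _ c] exI[of _ Q] exI[of _ R']) simp
    qed
  next
    case 3
    \<comment> \<open>Both factors of c have smaller degree: first a is cancelled, then b.\<close>
    then have nz: "a \<noteq> 0" "b \<noteq> 0" using less.prems(1) by auto
    then have "degree a < degree c" "degree b < degree c"
      using 3 by (auto simp: degree_mult_eq is_unit_iff_degree)
    moreover have "smult a (smult b P) = Q * R" using less.prems(2) 3(1) by simp
    ultimately obtain a1 a2 Q1 R1 where 1: "Q = smult a1 Q1" "R = smult a2 R1" "smult b P = Q1 * R1"
      using less.hyps nz by meson
    then obtain b1 b2 Q2 R2 where "Q1 = smult b1 Q2" "R1 = smult b2 R2" "P = Q2 * R2"
      using less.hyps nz \<open>degree b < degree c\<close> by meson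
    with 1 show ?thesis by (intro exI[of _ "a1 * b1"] exI[of _ "a2 * b2"] exI[of _ Q2] exI[of _ R2]) simp
  qed
qed

lemma fract_poly_clear_denominators:
  fixes Q :: "'a::idom fract poly"
  shows "\<exists>c Q'. c \<noteq> 0 \<and> map_poly to_fract Q' = smult (to_fract c) Q"
proof (induction Q)
  case 0
  show ?case by (intro exI[of _ 1] exI[of _ 0]) simp
next
  case (pCons x Q)
  obtain c Q' where c: "c \<noteq> 0" "map_poly to_fract Q' = smult (to_fract c) Q"
    using pCons.IH by blast
  obtain a b where x: "x = Fract a b" "b \<noteq> 0" by (cases x)
  then have x': "to_fract b * x = to_fract a"
    by (simp add: Fract_conv_to_fract)
  \<comment> \<open>Scaling by b * c clears the new coefficient a / b, and the factor c takes care
    of the old ones.\<close>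
  have "map_poly to_fract (pCons (a * c) (smult b Q')) = smult (to_fract (b * c)) (pCons x Q)"
    by (simp add: map_poly_pCons c(2) mult_ac flip: x')
  with x(2) c(1) show ?case by (meson mult_eq_0_iff)
qed

lemma pderiv_map_poly_to_fract: "pderiv (map_poly to_fract P) = map_poly to_fract (pderiv P)"
proof (rule poly_eqI)
  fix n
  have [simp]: "to_fract (of_nat m) = of_nat m" for m by (induction m) simp_all
  show "coeff (pderiv (map_poly to_fract P)) n = coeff (map_poly to_fract (pderiv P)) n"
    by (simp add: coeff_pderiv coeff_map_poly del: of_nat_Suc)
qed

lemma pderiv_map_poly_to_ac: "pderiv (map_poly to_ac P) = map_poly to_ac (pderiv P)"
  by (rule poly_eqI) (simp add: coeff_pderiv coeff_map_poly del: of_nat_Suc)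

interpretation to_ac: poly_hom "to_ac :: 'a::field \<Rightarrow> 'a alg_closure" x for x
  by unfold_locales simp_all

text \<open>
  A nonzero polynomial of minimal degree vanishing at a double root of \<open>Q\<close> must be associated
  with \<open>Q\<close>, whereas \<open>pderiv Q\<close> would have smaller degree.
\<close>

lemma pderiv_eq_0_of_not_rsquarefree:
  fixes Q :: "'a::field poly"
  assumes irred: "irreducible Q" and "\<not> rsquarefree (map_poly to_ac Q)"
  shows "pderiv Q = 0"
proof (rule ccontr)
  assume "pderiv Q \<noteq> 0"
  define ev where "ev R x = poly (map_poly to_ac R) x" for R :: "'a poly" and x
  have nz: "map_poly to_ac Q \<noteq> 0" using irred by (auto simp: map_poly_eq_0_iff)
  then obtain x where x: "order x (map_poly to_ac Q) \<noteq> 0" "order x (map_poly to_ac Q) \<noteq> 1"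
    using assms(2) by (auto simp: rsquarefree_def)
  \<comment> \<open>Multiplicity at least 2 makes x a common root of Q and its derivative.\<close>
  then have "2 \<le> order x (map_poly to_ac Q)" by linarith
  then have "[:- x, 1:] ^ 2 dvd map_poly to_ac Q"
    by (rule order_divides[THEN iffD2, OF disjI2])
  then obtain S where "map_poly to_ac Q = [:- x, 1:] ^ 2 * S" by blast
  then have S: "map_poly to_ac Q = [:- x, 1:] * ([:- x, 1:] * S)"
    by (simp only: power2_eq_square mult.assoc)
  have "ev Q x = 0" by (simp add: ev_def S)
  have "ev (pderiv Q) x = 0"
    unfolding ev_def pderiv_map_poly_to_ac[symmetric] S
    by (simp add: pderiv_mult del: mult_pCons_left)
  obtain g where g: "g \<noteq> 0" "ev g x = 0"
    "\<And>h. h \<noteq> 0 \<Longrightarrow> ev h x = 0 \<Longrightarrow> degree g \<le> degree h"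
    using ex_has_least_nat[of "\<lambda>h. h \<noteq> 0 \<and> ev h x = 0" "pderiv Q" degree]
      \<open>pderiv Q \<noteq> 0\<close> \<open>ev (pderiv Q) x = 0\<close> by blast
  have "ev Q x = ev (Q div g) x * ev g x + ev (Q mod g) x"
    unfolding ev_def by (simp flip: to_ac.eval_mult to_ac.eval_add)
  then have "ev (Q mod g) x = 0" using g(2) \<open>ev Q x = 0\<close> by simp
  then have "Q mod g = 0" using g degree_mod_less'[of g Q] by force
  then obtain k where k: "Q = g * k" by blast
  \<comment> \<open>A nonzero constant has no root, so irreducibility makes the cofactor
    \<open>k\<close> the unit.\<close>
  have "\<not> is_unit g"
    using g(1,2) by (auto simp: is_unit_poly_iff ev_def map_poly_pCons)
  then have "is_unit k" using irred k by (auto simp: irreducible_def)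
  then have "degree Q = degree g"
    using g(1) k by (auto simp: degree_mult_eq is_unit_poly_iff)
  moreover have "degree Q > 0"
    using irred by (metis gr0I irreducible_def is_unit_iff_degree)
  moreover have "degree (pderiv Q) \<le> degree Q - 1"
    by (rule degree_le) (simp add: coeff_pderiv coeff_eq_0)
  ultimately show False using g(3)[OF \<open>pderiv Q \<noteq> 0\<close> \<open>ev (pderiv Q) x = 0\<close>] by linarith
qed

text \<open>The inseparable irreducible factor lives over the rational functions in T. Clearing
  denominators and distributing the resulting scalar over both factors gives a polynomial factor A
  proportional to it, so positive degree and zero derivative persist.\<close>

lemma not_separable_polyE:
  fixes P :: "'a::{finite,field} poly poly"
  assumes "P \<noteq> 0" "\<not> separable_poly P"
  obtains A C where "P = A * C" "degree A > 0" "pderiv A = 0"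
proof -
  obtain Q :: "'a poly fract poly" where Q: "irreducible Q" "Q dvd map_poly to_fract P"
      "\<not> rsquarefree (map_poly to_ac Q)"
    using assms by (auto simp: separable_poly_def)
  obtain S where S: "map_poly to_fract P = Q * S" using Q(2) by blast
  obtain c Q' where c: "c \<noteq> 0" "map_poly to_fract Q' = smult (to_fract c) Q"
    using fract_poly_clear_denominators by blast
  obtain d S' where d: "d \<noteq> 0" "map_poly to_fract S' = smult (to_fract d) S"
    using fract_poly_clear_denominators by blast
  have "map_poly to_fract (smult (c * d) P) = map_poly to_fract (Q' * S')"
    by (simp add: S c(2) d(2) mult_ac del: fract_poly_eq_iff)
  then have "smult (c * d) P = Q' * S'" by (simp only: fract_poly_eq_iff)
  moreover have "c * d \<noteq> 0" using c(1) d(1) by simp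
  ultimately obtain a b A C where AC: "Q' = smult a A" "S' = smult b C" "P = A * C"
    using smult_eq_mult_imp_factors by meson
  have "map_poly to_fract (pderiv Q') = 0"
    by (simp add: c(2) pderiv_smult pderiv_eq_0_of_not_rsquarefree[OF Q(1,3)]
        flip: pderiv_map_poly_to_fract)
  then have pderiv: "pderiv Q' = 0" by simp
  have "degree Q' = degree (map_poly to_fract Q')"
    by (simp add: degree_map_poly)
  also have "\<dots> = degree Q" using c by simp
  also have "degree Q > 0" using Q(1) by (metis gr0I irreducible_def is_unit_iff_degree)
  finally have "degree Q' > 0" .
  then have "a \<noteq> 0" "degree A > 0" using AC(1) by (auto split: if_splits)
  moreover have "pderiv A = 0"
    using pderiv \<open>a \<noteq> 0\<close> by (simp add: AC(1) pderiv_smult)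
  ultimately show thesis using that AC(3) by blast
qed

text \<open>A vanishing derivative means n a_n = 0 for all n, so only exponents divisible by p occur
  and A(X) = R(X^p).\<close>

lemma exists_frobenius_preimage_of_pderiv_eq_0:
  fixes A :: "'a::{finite,field} poly poly"
  assumes "pderiv A = 0"
  obtains R where "CHAR('a) * degree R \<le> degree A" "height R \<le> height A"
    "eval_at R (\<xi> ^ CHAR('a)) = eval_at A \<xi>"
proof -
  let ?p = "CHAR('a)"
  have p_pos: "?p > 0" using prime_CHAR_finite_field prime_gt_0_nat by blast
  have coeff_A: "coeff A n = 0" if "\<not> ?p dvd n" for n
  proof (cases n)
    case (Suc m)
    have "of_nat (Suc m) * coeff A (Suc m) = coeff (pderiv A) m" by (simp add: coeff_pderiv)
    moreover have "(of_nat (Suc m) :: 'a poly) \<noteq> 0"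
      using that Suc by (simp only: of_nat_eq_0_iff_char_dvd semiring_char_poly not_False_eq_True)
    ultimately show ?thesis using assms Suc by (simp del: of_nat_Suc)
  qed (use that in simp)
  define R where "R = (\<Sum>i\<le>degree A. monom (coeff A (?p * i)) i)"
  have coeff_R: "coeff R i = coeff A (?p * i)" for i
  proof (cases "i \<le> degree A")
    case False
    moreover have "i \<le> ?p * i" using p_pos by simp
    ultimately have "degree A < ?p * i" by linarith
    then show ?thesis using False by (simp add: R_def coeff_sum coeff_eq_0)
  qed (simp add: R_def coeff_sum)
  show thesis
  proof (rule that[of R])
    show "?p * degree R \<le> degree A"
    proof (cases "R = 0")
      case False
      then have "coeff A (?p * degree R) \<noteq> 0" by (simp flip: coeff_R)
      then show ?thesis by (rule le_degree)
    qed simp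
    show "height R \<le> height A"
      by (simp add: height_le_iff coeff_R abs_coeff_le_height)
    have deg: "degree R \<le> degree A" by (rule degree_le) (simp add: R_def coeff_sum)
    \<comment> \<open>Extending the sum to p * degree A lets the multiples of p be indexed by all i
      \<le> degree A.\<close>
    have "eval_at A \<xi> = (\<Sum>i\<le>?p * degree A. poly_to_fls (coeff A i) * \<xi> ^ i)"
      using p_pos by (intro eval_at_eq_sum) simp
    also have "\<dots> = (\<Sum>i\<in>(\<lambda>i. ?p * i) ` {..degree A}. poly_to_fls (coeff A i) * \<xi> ^ i)"
    proof (rule sum.mono_neutral_right)
      show "\<forall>i\<in>{..?p * degree A} - (\<lambda>i. ?p * i) ` {..degree A}. poly_to_fls (coeff A i) * \<xi> ^ i = 0"
      proof
        fix i assume i: "i \<in> {..?p * degree A} - (\<lambda>i. ?p * i) ` {..degree A}"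
        then have "\<not> ?p dvd i" using p_pos by auto
        then show "poly_to_fls (coeff A i) * \<xi> ^ i = 0" by (simp add: coeff_A)
      qed
    qed auto
    also have "\<dots> = (\<Sum>i\<le>degree A. poly_to_fls (coeff R i) * (\<xi> ^ ?p) ^ i)"
      using p_pos by (subst sum.reindex) (auto simp: inj_on_def coeff_R power_mult)
    also have "\<dots> = eval_at R (\<xi> ^ ?p)" using deg by (simp add: eval_at_eq_sum)
    finally show "eval_at R (\<xi> ^ ?p) = eval_at A \<xi>" ..
  qed
qed

section \<open>Separable polynomials approximate as well as arbitrary ones\<close>

text \<open>Repeated factors are allowed in \<open>separable_poly\<close>, so it suffices that an
  irreducible factor of the product is prime and hence divides P or Q.\<close>

lemma separable_poly_mult:
  assumes "separable_poly P" "separable_poly Q"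
  shows "separable_poly (P * Q)"
proof -
  have "rsquarefree (map_poly to_ac R)"
    if "irreducible R" "R dvd map_poly to_fract (P * Q)" for R
  proof -
    have "prime_elem R" using that(1) by (rule field_poly_irreducible_imp_prime)
    then have "R dvd map_poly to_fract P \<or> R dvd map_poly to_fract Q"
      using that(2) by (simp add: prime_elem_dvd_mult_iff)
    then show ?thesis using assms that(1) by (auto simp: separable_poly_def)
  qed
  then show ?thesis using assms by (auto simp: separable_poly_def)
qed

text \<open>A factor of degree at most 1 has no multiple root. This covers the constant 1 and the
  linear polynomials behind the lower bound for the exponents.\<close>

lemma separable_poly_of_degree_le_1:
  assumes "P \<noteq> 0" "degree P \<le> 1"
  shows "separable_poly P"
  unfolding separable_poly_def
proof (intro conjI allI impI)
  fix Q :: "'a poly fract poly"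
  assume Q: "irreducible Q \<and> Q dvd map_poly to_fract P"
  then have nz: "map_poly to_ac Q \<noteq> 0" by (auto simp: map_poly_eq_0_iff)
  have "map_poly to_fract P \<noteq> 0" using assms(1) by simp
  then have "degree Q \<le> degree (map_poly to_fract P)" using Q by (simp add: dvd_imp_degree_le)
  also have "\<dots> \<le> 1" using assms(2) by (simp add: degree_map_poly)
  finally have "degree (map_poly to_ac Q) \<le> 1" by (simp add: degree_map_poly)
  then have "order x (map_poly to_ac Q) \<le> 1" for x
    using order_degree[OF nz, of x] by linarith
  then show "rsquarefree (map_poly to_ac Q)"
    using nz by (auto simp: rsquarefree_def le_Suc_eq)
qed (use assms in simp)

lemma separable_poly_power: "separable_poly P \<Longrightarrow> separable_poly (P ^ n)"
  by (induction n) (simp_all add: separable_poly_mult separable_poly_of_degree_le_1)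

text \<open>
  An inseparable factor \<open>A = R(X\<^sup>p)\<close> is replaced by the \<open>p\<close>-th power of a polynomial of smaller
  degree; multiplicativity of the height makes the replacement compatible with the cofactor.
\<close>

lemma exists_separable_approximation:
  fixes P :: "'a::{finite,field} poly poly"
  assumes "eval_at P \<xi> \<noteq> 0"
  shows "\<exists>S. separable_poly S \<and> degree S \<le> degree P \<and> height S \<le> height P \<and>
    eval_at S \<xi> \<noteq> 0 \<and> abs_fls (eval_at S \<xi>) \<le> abs_fls (eval_at P \<xi>)"
  using assms
proof (induction "degree P" arbitrary: P rule: less_induct)
  case less
  let ?p = "CHAR('a)"
  have p: "?p > 1" using prime_CHAR_finite_field prime_gt_1_nat by blast
  have "P \<noteq> 0" using less.prems by auto
  show ?case
  proof (cases "separable_poly P")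
    case False
    then obtain A C where AC: "P = A * C" "degree A > 0" "pderiv A = 0"
      using not_separable_polyE[OF \<open>P \<noteq> 0\<close>] by metis
    have nz: "A \<noteq> 0" "C \<noteq> 0" "eval_at A \<xi> \<noteq> 0" "eval_at C \<xi> \<noteq> 0"
      using less.prems \<open>P \<noteq> 0\<close> by (auto simp: AC(1) eval_at.eval_mult)
    have deg_P: "degree P = degree A + degree C" using nz by (simp add: AC(1) degree_mult_eq)
    obtain R where R: "?p * degree R \<le> degree A" "height R \<le> height A"
        "eval_at R (\<xi> ^ ?p) = eval_at A \<xi>"
      using exists_frobenius_preimage_of_pderiv_eq_0[OF AC(3)] by metis
    obtain B where B: "degree B \<le> degree R" "height B ^ ?p \<le> height R" "eval_at B \<xi> \<noteq> 0"
        "abs_fls (eval_at B \<xi>) ^ ?p \<le> abs_fls (eval_at R (\<xi> ^ ?p))"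
      using exists_frobenius_root[of R \<xi>] nz(3) R(3) by metis
    have deg_B: "?p * degree B \<le> degree A"
      using B(1) R(1) by (meson le_trans mult_le_mono2)
    \<comment> \<open>A nonconstant B has smaller degree than A because p > 1; a constant one
      because A is not constant. So the induction hypothesis applies to B.\<close>
    have "degree B < degree P"
    proof (cases "degree B = 0")
      case False
      then have "degree B < ?p * degree B" using p by simp
      with deg_B deg_P show ?thesis by linarith
    qed (use AC(2) deg_P in simp)
    then obtain S where S: "separable_poly S" "degree S \<le> degree B" "height S \<le> height B"
        "eval_at S \<xi> \<noteq> 0" "abs_fls (eval_at S \<xi>) \<le> abs_fls (eval_at B \<xi>)"
      using less.hyps B(3) by blast
    have "degree C < degree P" using AC(2) deg_P by simp
    then obtain S' where S': "separable_poly S'" "degree S' \<le> degree C" "height S' \<le> height C"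
        "eval_at S' \<xi> \<noteq> 0" "abs_fls (eval_at S' \<xi>) \<le> abs_fls (eval_at C \<xi>)"
      using less.hyps nz(4) by blast
    \<comment> \<open>\<open>S ^ p\<close> replaces A and \<open>S'\<close> replaces C; the bounds
      on p * degree B and on the p-th powers of the height and value of B pay for the p-th
      power.\<close>
    have "degree (S ^ ?p * S') \<le> ?p * degree S + degree S'"
      using degree_mult_le[of "S ^ ?p" S'] degree_power_le[of S ?p] by (simp add: mult.commute)
    also have "\<dots> \<le> degree P"
      using S(2) S'(2) deg_B deg_P by (metis add_mono le_trans mult_le_mono2)
    finally have deg: "degree (S ^ ?p * S') \<le> degree P" .
    have "height S ^ ?p \<le> height A"
      using S(3) B(2) R(2) by (meson height_nonneg order_trans power_mono)
    then have height: "height (S ^ ?p * S') \<le> height P"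
      using S'(3) by (simp add: AC(1) height_mult height_power mult_mono)
    have "abs_fls (eval_at S \<xi>) ^ ?p \<le> abs_fls (eval_at A \<xi>)"
      using S(5) B(4) R(3) by (metis abs_fls_nonneg order_trans power_mono)
    then have "abs_fls (eval_at (S ^ ?p * S') \<xi>) \<le> abs_fls (eval_at P \<xi>)"
      using S'(5)
      by (simp add: AC(1) eval_at.eval_mult eval_at_power abs_fls_mult abs_fls_power mult_mono)
    moreover have "eval_at (S ^ ?p * S') \<xi> \<noteq> 0"
      using S(4) S'(4) by (simp add: eval_at.eval_mult eval_at_power)
    ultimately show ?thesis
      using deg height S(1) S'(1) separable_poly_mult separable_poly_power by blast
  qed (use less.prems in blast)
qed

section \<open>Comparison of exponents by transferring solutions\<close>

text \<open>Bounded height bounds the degrees of the coefficients in T, and the field is finite. The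
  local fact \<open>polys\<close> serves at two levels, for polynomials in T and then in X.\<close>

lemma finite_bounded_degree_height:
  "finite {P :: 'a::{finite,field} poly poly. degree P \<le> n \<and> height P \<le> C}"
proof -
  have polys: "finite {p :: 'b::zero poly. degree p \<le> m \<and> set (coeffs p) \<subseteq> S}"
    if "finite S" for S and m
  proof (rule finite_subset)
    show "{p :: 'b poly. degree p \<le> m \<and> set (coeffs p) \<subseteq> S}
        \<subseteq> Poly ` {xs. set xs \<subseteq> S \<and> length xs \<le> Suc m}"
    proof
      fix p :: "'b poly" assume "p \<in> {p. degree p \<le> m \<and> set (coeffs p) \<subseteq> S}"
      moreover have "length (coeffs p) \<le> Suc (degree p)"
        by (cases "p = 0") (simp_all add: length_coeffs_degree)
      ultimately show "p \<in> Poly ` {xs. set xs \<subseteq> S \<and> length xs \<le> Suc m}"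
        by (intro image_eqI[of _ _ "coeffs p"]) auto
    qed
    show "finite (Poly ` {xs. set xs \<subseteq> S \<and> length xs \<le> Suc m})"
      using that by (intro finite_imageI finite_lists_length_le)
  qed
  obtain m where m: "C < real CARD('a) ^ m"
    using real_arch_pow[OF card_field_gt_1] by blast
  let ?S = "{a :: 'a poly. degree a \<le> m \<and> set (coeffs a) \<subseteq> UNIV}"
  have "set (coeffs P) \<subseteq> ?S" if "height P \<le> C" for P :: "'a poly poly"
  proof
    fix a assume "a \<in> set (coeffs P)"
    then obtain i where i: "a = coeff P i" by (auto simp: coeffs_def split: if_splits)
    show "a \<in> ?S"
    proof (cases "a = 0")
      case False
      then have "real CARD('a) ^ degree a \<le> C"
        using that i by (metis abs_fls_poly_to_fls height_le_iff)
      then have "degree a < m"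
        using m card_field_gt_1[where 'a='a] by (meson le_less_trans power_less_imp_less_exp)
      then show ?thesis by simp
    qed simp
  qed
  then have "{P :: 'a poly poly. degree P \<le> n \<and> height P \<le> C}
      \<subseteq> {P. degree P \<le> n \<and> set (coeffs P) \<subseteq> ?S}" by auto
  moreover have "finite {P :: 'a poly poly. degree P \<le> n \<and> set (coeffs P) \<subseteq> ?S}"
    by (intro polys) simp
  ultimately show ?thesis by (rule finite_subset)
qed

lemma powr_le_cancel_iff_base:
  fixes x y r :: real
  assumes "0 < r" "0 \<le> x" "0 \<le> y"
  shows "x powr r \<le> y powr r \<longleftrightarrow> x \<le> y"
  using assms powr_less_mono2[of r y x] powr_mono2[of r x y] by (meson less_le_not_le not_le less_imp_le)

text \<open>Each admissible w carries over unchanged: for a bound H the solution P is taken at the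
  bound H^r, and the inequalities for its transfer then hold after removing the power r.\<close>

lemma w_hat_exponent_on_le:
  fixes \<xi> \<eta> :: "'a::{finite,field} fls"
  assumes r: "r > 0"
    and transfer: "\<And>P. P \<in> A \<Longrightarrow> degree P \<le> n \<Longrightarrow> eval_at P \<xi> \<noteq> 0 \<Longrightarrow>
      \<exists>Q\<in>B. degree Q \<le> n \<and> height Q powr r \<le> height P \<and> eval_at Q \<eta> \<noteq> 0 \<and>
        abs_fls (eval_at Q \<eta>) powr r \<le> abs_fls (eval_at P \<xi>)"
  shows "w_hat_exponent_on A n \<xi> \<le> w_hat_exponent_on B n \<eta>"
  unfolding w_hat_exponent_on_def
proof (intro Sup_subset_mono image_mono Collect_mono impI)
  fix w assume "\<exists>H\<^sub>0::real. \<forall>H>H\<^sub>0. \<exists>P\<in>A. degree P \<le> n \<and> height P \<le> H \<and>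
    0 < abs_fls (eval_at P \<xi>) \<and> abs_fls (eval_at P \<xi>) < H powr (- w)"
  then obtain H\<^sub>0 where H\<^sub>0: "\<And>H. H > H\<^sub>0 \<Longrightarrow> \<exists>P\<in>A. degree P \<le> n \<and> height P \<le> H \<and>
    0 < abs_fls (eval_at P \<xi>) \<and> abs_fls (eval_at P \<xi>) < H powr (- w)" by blast
  \<comment> \<open>Chosen so that H > \<open>H\<^sub>1\<close> implies H^r >
    \<open>H\<^sub>0\<close>; the maximum with 1 keeps the base positive.\<close>
  define H\<^sub>1 where "H\<^sub>1 = max 1 H\<^sub>0 powr (1 / r)"
  have "\<exists>Q\<in>B. degree Q \<le> n \<and> height Q \<le> H \<and>
    0 < abs_fls (eval_at Q \<eta>) \<and> abs_fls (eval_at Q \<eta>) < H powr (- w)" if "H > H\<^sub>1" for H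
  proof -
    have "0 \<le> H\<^sub>1" by (simp add: H\<^sub>1_def)
    then have "H > 0" using that by linarith
    have "H\<^sub>1 powr r = max 1 H\<^sub>0" using r by (simp add: H\<^sub>1_def powr_powr)
    moreover have "H\<^sub>1 powr r < H powr r"
      using r \<open>0 \<le> H\<^sub>1\<close> that by (rule powr_less_mono2)
    ultimately have "H\<^sub>0 < H powr r" by simp
    then obtain P where P: "P \<in> A" "degree P \<le> n" "height P \<le> H powr r" "eval_at P \<xi> \<noteq> 0"
      "abs_fls (eval_at P \<xi>) < (H powr r) powr (- w)" using H\<^sub>0 by (metis abs_fls_pos_iff)
    obtain Q where Q: "Q \<in> B" "degree Q \<le> n" "height Q powr r \<le> height P" "eval_at Q \<eta> \<noteq> 0"
      "abs_fls (eval_at Q \<eta>) powr r \<le> abs_fls (eval_at P \<xi>)"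
      using transfer[OF P(1,2,4)] by blast
    have "height Q powr r \<le> H powr r" using Q(3) P(3) by linarith
    then have "height Q \<le> H"
      using r \<open>H > 0\<close> by (simp add: powr_le_cancel_iff_base)
    moreover have "abs_fls (eval_at Q \<eta>) powr r < (H powr (- w)) powr r"
      using Q(5) P(5) by (simp add: powr_powr mult.commute)
    then have "abs_fls (eval_at Q \<eta>) < H powr (- w)"
      using r by (metis abs_fls_nonneg not_le powr_ge_zero powr_le_cancel_iff_base)
    ultimately show ?thesis using Q by auto
  qed
  then show "\<exists>H\<^sub>0::real. \<forall>H>H\<^sub>0. \<exists>Q\<in>B. degree Q \<le> n \<and> height Q \<le> H \<and>
    0 < abs_fls (eval_at Q \<eta>) \<and> abs_fls (eval_at Q \<eta>) < H powr (- w)" by blast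
qed

text \<open>
  Solutions for a positive exponent have unbounded height, hence arbitrarily small values, so
  infinitely many of their transfers are distinct; exponents \<open>w \<le> 0\<close> are covered by the
  assumption that the right-hand side is nonnegative.
\<close>

lemma w_exponent_on_le:
  fixes \<xi> \<eta> :: "'a::{finite,field} fls"
  assumes r: "r > 0"
    and transfer: "\<And>P. P \<in> A \<Longrightarrow> degree P \<le> n \<Longrightarrow> eval_at P \<xi> \<noteq> 0 \<Longrightarrow>
      \<exists>Q\<in>B. degree Q \<le> n \<and> height Q powr r \<le> height P \<and> eval_at Q \<eta> \<noteq> 0 \<and>
        abs_fls (eval_at Q \<eta>) powr r \<le> abs_fls (eval_at P \<xi>)"
    and nonneg: "0 \<le> w_exponent_on B n \<eta>"
  shows "w_exponent_on A n \<xi> \<le> w_exponent_on B n \<eta>"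
  unfolding w_exponent_on_def[of A]
proof (rule Sup_least, clarify)
  fix w
  define S where "S = {P \<in> A. degree P \<le> n \<and>
    0 < abs_fls (eval_at P \<xi>) \<and> abs_fls (eval_at P \<xi>) < height P powr (- w)}"
  assume "infinite {P \<in> A. degree P \<le> n \<and>
    0 < abs_fls (eval_at P \<xi>) \<and> abs_fls (eval_at P \<xi>) < height P powr (- w)}"
  then have inf: "infinite S" by (simp add: S_def)
  show "ereal w \<le> w_exponent_on B n \<eta>"
  proof (cases "w > 0")
    case False
    then show ?thesis using nonneg by (meson ereal_less_eq(4) not_le order_trans linorder_not_less)
  next
    case True
    have "\<exists>Q. Q \<in> B \<and> degree Q \<le> n \<and> height Q powr r \<le> height P \<and> eval_at Q \<eta> \<noteq> 0 \<and>
        abs_fls (eval_at Q \<eta>) powr r \<le> abs_fls (eval_at P \<xi>)" if "P \<in> S" for P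
      using transfer[of P] that by (auto simp: S_def)
    then obtain Q where Q: "\<And>P. P \<in> S \<Longrightarrow> Q P \<in> B \<and> degree (Q P) \<le> n \<and>
        height (Q P) powr r \<le> height P \<and> eval_at (Q P) \<eta> \<noteq> 0 \<and>
        abs_fls (eval_at (Q P) \<eta>) powr r \<le> abs_fls (eval_at P \<xi>)" by metis
    have "infinite (Q ` S)"
    proof
      assume fin: "finite (Q ` S)"
      \<comment> \<open>With finitely many transfers there is a least value \<mu> > 0. Then \<mu>^r
        bounds every |P(\<xi>)| from below, which bounds the height of P and leaves only finitely
        many P.\<close>
      define \<mu> where "\<mu> = Min ((\<lambda>R. abs_fls (eval_at R \<eta>)) ` (Q ` S))"
      have "S \<noteq> {}" using inf by auto
      then have "\<mu> \<in> (\<lambda>R. abs_fls (eval_at R \<eta>)) ` (Q ` S)"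
        unfolding \<mu>_def using fin by (intro Min_in) auto
      then have "\<mu> > 0" using Q by auto
      have "height P \<le> \<mu> powr (- r / w)" if "P \<in> S" for P
      proof -
        have "P \<noteq> 0" using that by (auto simp: S_def)
        then have h: "height P \<ge> 1" by (rule height_ge_1)
        have "\<mu> \<le> abs_fls (eval_at (Q P) \<eta>)"
          unfolding \<mu>_def using fin that by (intro Min_le) auto
        then have "\<mu> powr r \<le> abs_fls (eval_at (Q P) \<eta>) powr r"
          using r \<open>\<mu> > 0\<close> by (intro powr_mono2) auto
        also have "\<dots> \<le> abs_fls (eval_at P \<xi>)" using Q[OF that] by blast
        also have "\<dots> \<le> height P powr (- w)" using that by (simp add: S_def)
        finally have "(height P powr (- w)) powr (- 1 / w) \<le> (\<mu> powr r) powr (- 1 / w)"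
          using True \<open>\<mu> > 0\<close> by (intro powr_mono2') auto
        then show ?thesis using True h by (simp add: powr_powr)
      qed
      then have "S \<subseteq> {P. degree P \<le> n \<and> height P \<le> \<mu> powr (- r / w)}" by (auto simp: S_def)
      then show False using inf finite_bounded_degree_height finite_subset by blast
    qed
    moreover have "Q ` S \<subseteq> {P \<in> B. degree P \<le> n \<and>
      0 < abs_fls (eval_at P \<eta>) \<and> abs_fls (eval_at P \<eta>) < height P powr (- w)}"
    proof clarify
      fix P assume P: "P \<in> S"
      have "Q P \<noteq> 0" using Q[OF P] by auto
      then have h: "height (Q P) \<ge> 1" by (rule height_ge_1)
      have "abs_fls (eval_at (Q P) \<eta>) powr r < height P powr (- w)"
        using Q[OF P] P by (auto simp: S_def)
      \<comment> \<open>The exponent -w is negative, so the smaller height of the transfer gives the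
        larger bound.\<close>
      also have "\<dots> \<le> (height (Q P) powr r) powr (- w)"
        using True h Q[OF P] by (intro powr_mono2') auto
      finally have "abs_fls (eval_at (Q P) \<eta>) powr r < (height (Q P) powr (- w)) powr r"
        by (simp add: powr_powr mult.commute)
      then have "abs_fls (eval_at (Q P) \<eta>) < height (Q P) powr (- w)"
        using r by (metis abs_fls_nonneg not_le powr_ge_zero powr_le_cancel_iff_base)
      then show "Q P \<in> B \<and> degree (Q P) \<le> n \<and> 0 < abs_fls (eval_at (Q P) \<eta>) \<and>
          abs_fls (eval_at (Q P) \<eta>) < height (Q P) powr (- w)"
        using Q[OF P] by simp
    qed
    ultimately have "infinite {P \<in> B. degree P \<le> n \<and>
      0 < abs_fls (eval_at P \<eta>) \<and> abs_fls (eval_at P \<eta>) < height P powr (- w)}"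
      using finite_subset by blast
    then show ?thesis unfolding w_exponent_on_def by (intro Sup_upper) auto
  qed
qed

text \<open>The linear polynomials T^k X + a with 0 < |T^k \<xi> + a| \<le> 1 have height at least
  q^k, so every w < 0 has infinitely many solutions.\<close>

lemma w_exponent_on_nonneg:
  fixes \<xi> :: "'a::{finite,field} fls"
  assumes "n \<ge> 1" and B: "\<And>P. separable_poly P \<Longrightarrow> P \<in> B"
  shows "0 \<le> w_exponent_on B n \<xi>"
proof -
  have q: "real CARD('a) > 1" by (rule card_field_gt_1)
  have "\<exists>a. fls_X_inv ^ k * \<xi> + poly_to_fls a \<noteq> 0 \<and>
      abs_fls (fls_X_inv ^ k * \<xi> + poly_to_fls a) \<le> 1" for k
  proof -
    define x where "x = fls_X_inv ^ k * \<xi>"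
    \<comment> \<open>\<open>b\<close> is the polynomial part of \<open>x\<close>;
      \<open>fls_prpart\<close> omits index 0, hence the added constant. Then x + 1 - b is 1 plus a
      fractional part, so it is nonzero even when \<open>x\<close> is a polynomial in T.\<close>
    define b where "b = [:fls_nth x 0:] + fls_prpart x"
    have nth: "fls_nth (x - poly_to_fls b) i = 0" if "i \<le> 0" for i
      using that by (cases "i = 0") (simp_all add: fls_nth_poly_to_fls b_def coeff_pCons split: nat.splits)
    have unit: "fls_nth (x + poly_to_fls (1 - b)) i = (if i = 0 then 1 else 0)" if "i \<le> 0" for i
      using nth[OF that] that by (simp add: fls_nth_poly_to_fls)
    have nz: "x + poly_to_fls (1 - b) \<noteq> 0" using unit[of 0] by (metis fls_zero_nth order_refl zero_neq_one)
    moreover have "fls_subdegree (x + poly_to_fls (1 - b)) \<ge> 0"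
      using nz unit by (intro fls_subdegree_geI) auto
    then have "abs_fls (x + poly_to_fls (1 - b)) \<le> 1"
      using abs_fls_mono[of 1 "x + poly_to_fls (1 - b)"] by simp
    ultimately show ?thesis unfolding x_def by blast
  qed
  then obtain a where a: "\<And>k. fls_X_inv ^ k * \<xi> + poly_to_fls (a k) \<noteq> 0"
    "\<And>k. abs_fls (fls_X_inv ^ k * \<xi> + poly_to_fls (a k)) \<le> 1" by metis
  define P where "P k = [:a k, monom 1 k:]" for k
  have eval_P: "eval_at (P k) \<xi> = fls_X_inv ^ k * \<xi> + poly_to_fls (a k)" for k
    by (simp add: P_def eval_at.eval_pCons poly_to_fls_monom)
  have "inj P" by (rule injI) (auto simp: P_def monom_eq_iff')
  have "ereal w \<le> w_exponent_on B n \<xi>" if "w < 0" for w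
  proof -
    \<comment> \<open>Starting at k = 1 ensures height > 1, so that a positive power of it exceeds 1
      strictly.\<close>
    have "P ` {1..} \<subseteq> {P \<in> B. degree P \<le> n \<and>
      0 < abs_fls (eval_at P \<xi>) \<and> abs_fls (eval_at P \<xi>) < height P powr (- w)}"
    proof clarify
      fix k :: nat assume "1 \<le> k"
      then have "1 < real CARD('a) ^ k" using q by (simp add: one_less_power)
      also have "\<dots> \<le> height (P k)"
        using abs_coeff_le_height[of "P k" 1]
        by (simp add: P_def abs_fls_poly_to_fls degree_monom_eq)
      finally have "1 < height (P k) powr (- w)"
        using \<open>w < 0\<close> by simp
      moreover have "P k \<in> B"
        by (intro B separable_poly_of_degree_le_1) (simp_all add: P_def)
      moreover have "degree (P k) \<le> n" using \<open>n \<ge> 1\<close> by (simp add: P_def)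
      ultimately show "P k \<in> B \<and> degree (P k) \<le> n \<and> 0 < abs_fls (eval_at (P k) \<xi>) \<and>
          abs_fls (eval_at (P k) \<xi>) < height (P k) powr (- w)"
        using a[of k] by (simp add: eval_P)
    qed
    moreover have "infinite (P ` {1..})"
      using \<open>inj P\<close> by (simp add: finite_image_iff inj_on_subset infinite_Ici)
    ultimately have "infinite {P \<in> B. degree P \<le> n \<and>
      0 < abs_fls (eval_at P \<xi>) \<and> abs_fls (eval_at P \<xi>) < height P powr (- w)}"
      using finite_subset by blast
    then show ?thesis unfolding w_exponent_on_def by (intro Sup_upper) auto
  qed
  then show ?thesis
    using ereal_dense2[of "w_exponent_on B n \<xi>" 0] by force
qed

section \<open>The characteristic, and assembly of the four equalities\<close>

text \<open>Translation by 1 permutes the field, so comparing the sums of all elements shows that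
  the characteristic divides p^m; being prime, it is p.\<close>

lemma CHAR_eq_of_CARD_eq_prime_power:
  assumes "prime p" "CARD('a::{finite,field}) = p ^ m"
  shows "CHAR('a) = p"
proof -
  have "(\<Sum>x\<in>UNIV. x + 1) = (\<Sum>x\<in>UNIV. x :: 'a)"
    by (rule sum.reindex_bij_witness[of _ "\<lambda>x. x - 1" "\<lambda>x. x + 1"]) auto
  then have "of_nat CARD('a) = (0 :: 'a)" by (simp add: sum.distrib)
  then have "CHAR('a) dvd p ^ m" by (simp add: assms(2) of_nat_eq_0_iff_char_dvd del: of_nat_power)
  then show ?thesis
    using assms(1) prime_CHAR_finite_field[where 'a='a] by (metis prime_dvd_power primes_dvd_imp_eq)
qed

theorem theorem2p2:
  fixes p q n :: nat and \<xi> :: "'a::{finite,field} fls"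
  assumes "prime p"
    and "\<exists>m\<ge>1. q = p ^ m"
    and "CARD('a) = q"
    and "n \<ge> 1"
  shows "w_exponent n \<xi> = w_exponent_sep n \<xi> \<and>
         w_hat_exponent n \<xi> = w_hat_exponent_sep n \<xi> \<and>
         w_exponent n \<xi> = w_exponent n (\<xi> ^ p) \<and>
         w_hat_exponent n \<xi> = w_hat_exponent n (\<xi> ^ p)"
proof -
  have p: "p = CHAR('a)" using assms CHAR_eq_of_CARD_eq_prime_power[of p] by metis
  have "p > 0" using assms(1) by (rule prime_gt_0_nat)
  \<comment> \<open>Turns the real power 1/p in the comparison lemmas into an ordinary p-th power on
    the other side.\<close>
  have root: "x powr (1 / real p) \<le> y \<longleftrightarrow> x \<le> y ^ p" if "0 \<le> x" "0 \<le> y" for x y :: real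
  proof -
    have "x powr (1 / real p) \<le> y \<longleftrightarrow> (x powr (1 / real p)) powr real p \<le> y powr real p"
      using \<open>p > 0\<close> that by (simp add: powr_le_cancel_iff_base)
    then show ?thesis using \<open>p > 0\<close> that by (simp add: powr_powr powr_realpow')
  qed
  let ?sep = "{P. separable_poly P} :: 'a poly poly set"
  \<comment> \<open>Inputs to the comparison lemmas: \<open>sep\<close> with r = 1,
    \<open>up\<close> with r = 1/p, \<open>down\<close> with r = p.\<close>
  have sep: "\<exists>Q\<in>?sep. degree Q \<le> n \<and> height Q powr 1 \<le> height P \<and> eval_at Q \<xi> \<noteq> 0 \<and>
      abs_fls (eval_at Q \<xi>) powr 1 \<le> abs_fls (eval_at P \<xi>)"
    if "degree P \<le> n" "eval_at P \<xi> \<noteq> 0" for P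
    using exists_separable_approximation[OF that(2)] that(1) by auto
  have up: "\<exists>Q\<in>UNIV. degree Q \<le> n \<and> height Q powr (1 / p) \<le> height P \<and>
      eval_at Q (\<xi> ^ p) \<noteq> 0 \<and> abs_fls (eval_at Q (\<xi> ^ p)) powr (1 / p) \<le> abs_fls (eval_at P \<xi>)"
    if P: "degree P \<le> n" "eval_at P \<xi> \<noteq> 0" for P
  proof -
    obtain Q where "degree Q \<le> degree P" "height Q = height P ^ p"
        "eval_at Q (\<xi> ^ p) = eval_at P \<xi> ^ p"
      using exists_frobenius_power[of P \<xi>] unfolding p by metis
    then show ?thesis using P by (intro bexI[of _ Q]) (simp_all add: root abs_fls_power)
  qed
  have down: "\<exists>Q\<in>UNIV. degree Q \<le> n \<and> height Q powr p \<le> height P \<and>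
      eval_at Q \<xi> \<noteq> 0 \<and> abs_fls (eval_at Q \<xi>) powr p \<le> abs_fls (eval_at P (\<xi> ^ p))"
    if P: "degree P \<le> n" "eval_at P (\<xi> ^ p) \<noteq> 0" for P
  proof -
    obtain Q where "degree Q \<le> degree P" "height Q ^ p \<le> height P" "eval_at Q \<xi> \<noteq> 0"
        "abs_fls (eval_at Q \<xi>) ^ p \<le> abs_fls (eval_at P (\<xi> ^ p))"
      using exists_frobenius_root[of P \<xi>] P(2) unfolding p by metis
    then show ?thesis
      using P \<open>p > 0\<close> by (intro bexI[of _ Q]) (simp_all add: powr_realpow')
  qed
  have nonneg: "0 \<le> w_exponent_on UNIV n \<eta>" "0 \<le> w_exponent_on ?sep n \<eta>" for \<eta> :: "'a fls"
    by (rule w_exponent_on_nonneg[OF assms(4)]; simp)+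
  have "w_exponent n \<xi> \<le> w_exponent_sep n \<xi>"
    unfolding w_exponent_def w_exponent_sep_def
    using sep nonneg(2) by (intro w_exponent_on_le[of 1]) auto
  \<comment> \<open>A separable polynomial is its own transfer.\<close>
  moreover have "w_exponent_sep n \<xi> \<le> w_exponent n \<xi>"
    unfolding w_exponent_def w_exponent_sep_def
    using nonneg(1) by (intro w_exponent_on_le[of 1]) auto
  moreover have "w_hat_exponent n \<xi> \<le> w_hat_exponent_sep n \<xi>"
    unfolding w_hat_exponent_def w_hat_exponent_sep_def
    using sep by (intro w_hat_exponent_on_le[of 1]) auto
  moreover have "w_hat_exponent_sep n \<xi> \<le> w_hat_exponent n \<xi>"
    unfolding w_hat_exponent_def w_hat_exponent_sep_def
    by (intro w_hat_exponent_on_le[of 1]) auto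
  moreover have "w_exponent n \<xi> \<le> w_exponent n (\<xi> ^ p)"
    unfolding w_exponent_def using up nonneg(1) \<open>p > 0\<close> by (intro w_exponent_on_le[of "1 / p"]) simp_all
  moreover have "w_exponent n (\<xi> ^ p) \<le> w_exponent n \<xi>"
    unfolding w_exponent_def using down nonneg(1) \<open>p > 0\<close> by (intro w_exponent_on_le[of p]) simp_all
  moreover have "w_hat_exponent n \<xi> \<le> w_hat_exponent n (\<xi> ^ p)"
    unfolding w_hat_exponent_def using up \<open>p > 0\<close> by (intro w_hat_exponent_on_le[of "1 / p"]) simp_all
  moreover have "w_hat_exponent n (\<xi> ^ p) \<le> w_hat_exponent n \<xi>"
    unfolding w_hat_exponent_def using down \<open>p > 0\<close> by (intro w_hat_exponent_on_le[of p]) simp_all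
  ultimately show ?thesis by (intro conjI antisym)
qed

end
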